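(* Let $n\ge1$, $\varepsilon\in\{+,-\}^{n-1}$, and $R=\{r_1<\cdots<r_s=n\}\subseteq[n]$; set $r_0=0$. The undirected Hasse diagram of $Q_{\varepsilon,R}$ is a caterpillar with spine $$r_1-r_2-\cdots-r_s.$$ For $r_{j-1}<i<r_j$, the vertex $i$ is a leaf adjacent to $r_j$, and $$i<_{Q_{\varepsilon,R}}r_j\quad\Longleftrightarrow\quad\varepsilon_i=+.$$ For $2\le j\le s$, the orientation of the $j$-th spine edge (the edge between $r_{j-1}$ and $r_j$) is $$r_{j-1}<_{Q_{\varepsilon,R}}r_j\quad\Longleftrightarrow\quad\varepsilon_{r_{j-1}}=-.$$
   Context: For $R\subseteq[n]$ with $n\in R$ and $i<n$, let $\rho_R(i)=\min\{r\in R:r>i\}$. The record poset $Q_{\varepsilon,R}$ is the poset on $[n]$ that is the transitive closure of the following relations, one for each $i<n$: $i<\rho_R(i)$ if ($\varepsilon_i=+$ and $i\notin R$) or ($\varepsilon_i=-$ and $i\in R$); otherwise $\rho_R(i)<i$. A caterpillar with a given spine is a tree consisting of a path (the spine) together with leaves each adjacent to a vertex of the spine. *)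

theory Defs
  imports "Graph_Theory.Graph_Theory"
begin

section \<open>Record posets\<close>

datatype sign = Plus | Minus

definition next_record :: "nat set \<Rightarrow> nat \<Rightarrow> nat" where
  "next_record R i = Min {r \<in> R. i < r}"

text \<open>
  A sign vector of length \<open>n - 1\<close> is a function on \<^typ>\<open>nat\<close>, of which only the values
  at \<open>1, \<dots>, n - 1\<close> are ever used. A pair \<open>(x, y)\<close> stands for \<open>x < y\<close>.
\<close>
definition record_relations :: "nat \<Rightarrow> (nat \<Rightarrow> sign) \<Rightarrow> nat set \<Rightarrow> nat rel" where
  "record_relations n \<epsilon> R =
    (\<lambda>i. if \<epsilon> i = Plus \<and> i \<notin> R \<or> \<epsilon> i = Minus \<and> i \<in> R
         then (i, next_record R i) else (next_record R i, i)) ` {1..<n}"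

text \<open>The order is reflexive, as required by \<^const>\<open>partial_order_on\<close>.\<close>
definition record_poset :: "nat \<Rightarrow> (nat \<Rightarrow> sign) \<Rightarrow> nat set \<Rightarrow> nat rel" where
  "record_poset n \<epsilon> R = Id_on {1..n} \<union> (record_relations n \<epsilon> R)\<^sup>+"


section \<open>Hasse diagrams\<close>

definition less_in :: "'a rel \<Rightarrow> 'a \<Rightarrow> 'a \<Rightarrow> bool" where
  "less_in P x y \<longleftrightarrow> (x, y) \<in> P \<and> x \<noteq> y"

definition covered_by :: "'a rel \<Rightarrow> 'a \<Rightarrow> 'a \<Rightarrow> bool" where
  "covered_by P x y \<longleftrightarrow> less_in P x y \<and> \<not> (\<exists>z. less_in P x z \<and> less_in P z y)"

text \<open>
  As in the graph library, an undirected graph is a symmetric digraph: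
  an edge \<open>{x, y}\<close> is the pair of arcs \<open>(x, y)\<close>, \<open>(y, x)\<close>.
\<close>
definition hasse_graph :: "'a set \<Rightarrow> 'a rel \<Rightarrow> 'a pair_pre_digraph" where
  "hasse_graph A P =
    \<lparr> pverts = A, parcs = {(x, y). covered_by P x y \<or> covered_by P y x} \<rparr>"


section \<open>Caterpillars\<close>

text \<open>
  The library's \<^const>\<open>tree\<close> forbids all directed cycles; in a symmetric digraph every edge
  gives one of length 2, so for undirected graphs only cycles of length at least 3 count.
\<close>
definition undirected_tree :: "'a pair_pre_digraph \<Rightarrow> bool" where
  "undirected_tree G \<longleftrightarrow> pair_graph G \<and> connected (with_proj G) \<and>
     \<not> (\<exists>p. pre_digraph.cycle (with_proj G) p \<and> 3 \<le> length p)"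

text \<open>In a symmetric digraph the out-degree is the undirected degree.\<close>
definition leaf :: "'a pair_pre_digraph \<Rightarrow> 'a \<Rightarrow> bool" where
  "leaf G v \<longleftrightarrow> v \<in> pverts G \<and> out_degree (with_proj G) v = 1"

definition caterpillar_with_spine :: "'a pair_pre_digraph \<Rightarrow> 'a list \<Rightarrow> bool" where
  "caterpillar_with_spine G p \<longleftrightarrow> undirected_tree G \<and> vpath p (with_proj G) \<and>
     (\<forall>v \<in> pverts G - set p. leaf G v \<and> (\<exists>u \<in> set p. (v, u) \<in> parcs G))"

end

theory Submission
  imports Defs
begin

text \<open>
  Sending each \<open>i < n\<close> to the next record \<open>\<rho>(i)\<close> above it makes \<open>[n]\<close> a tree rooted at \<open>n\<close>, and
  the defining relations of the record poset are exactly the edges of this tree, each with one of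
  its two orientations. The combinatorics of the tree is immediate: no non-record is the parent of
  anything, so a non-record is a leaf hanging from the next record, while the records themselves
  form the path \<open>r\<^sub>1, \<dots>, r\<^sub>s\<close>. What needs an argument is that passing to the transitive
  closure and then to the covering relation gives the tree back, for an arbitrary orientation.

  The reason is that an oriented tree is graded: a height can be chosen freely at the root and then
  propagated to the descendants so that every oriented edge climbs by exactly 1
  (\<open>height_along_parents\<close>). Heights strictly increase along the transitive closure, so the
  closure is antisymmetric; and since an integer height leaves no room strictly between \<open>h\<close>
  and \<open>h + 1\<close>, every oriented edge is a cover and there are no other covers
  (\<open>partial_order_graded\<close>, \<open>covered_by_graded\<close>). Antisymmetry also turns the orientation of
  a single edge into the stated equivalences.

  That the parent edges form a tree uses only that parents are larger than their children: the
  smallest vertex of a cycle would have its parent as both its predecessor and its successor,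
  whereas these are two different vertices in a cycle of length at least 3 (\<open>no_long_cycle\<close>).
\<close>

section \<open>Orders generated by a graded relation\<close>

lemma graded_trancl_less:
  fixes h :: "'a \<Rightarrow> int"
  assumes "\<forall>(x, y) \<in> E. h y = h x + 1" and "(x, y) \<in> E\<^sup>+"
  shows "h x < h y"
  using assms(2) by (induction rule: trancl_induct) (use assms(1) in fastforce)+

lemma partial_order_graded:
  fixes h :: "'a \<Rightarrow> int"
  assumes "E \<subseteq> A \<times> A" and "\<forall>(x, y) \<in> E. h y = h x + 1"
  shows "partial_order_on A (Id_on A \<union> E\<^sup>+)"
proof -
  have "E\<^sup>+ \<subseteq> A \<times> A"
    by (rule trancl_subset_Sigma[OF assms(1)])
  moreover have "antisym (Id_on A \<union> E\<^sup>+)"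
    by (rule antisymI) (auto dest!: graded_trancl_less[OF assms(2)])
  ultimately show ?thesis
    unfolding partial_order_on_def preorder_on_def
    by (auto intro!: refl_onI transI intro: trancl_trans)
qed

lemma less_in_graded:
  fixes h :: "'a \<Rightarrow> int"
  assumes "\<forall>(x, y) \<in> E. h y = h x + 1"
  shows "less_in (Id_on A \<union> E\<^sup>+) x y \<longleftrightarrow> (x, y) \<in> E\<^sup>+"
  unfolding less_in_def using graded_trancl_less[OF assms] by fastforce

lemma covered_by_graded:
  fixes h :: "'a \<Rightarrow> int"
  assumes h: "\<forall>(x, y) \<in> E. h y = h x + 1"
  shows "covered_by (Id_on A \<union> E\<^sup>+) x y \<longleftrightarrow> (x, y) \<in> E"
proof
  assume "covered_by (Id_on A \<union> E\<^sup>+) x y"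
  then have xy: "(x, y) \<in> E\<^sup>+" and no: "\<And>z. (x, z) \<in> E\<^sup>+ \<Longrightarrow> (z, y) \<notin> E\<^sup>+"
    unfolding covered_by_def less_in_graded[OF h] by auto
  from xy show "(x, y) \<in> E"
    by (cases rule: tranclE) (auto dest: no)
next
  assume "(x, y) \<in> E"
  moreover have False if "(x, z) \<in> E\<^sup>+" "(z, y) \<in> E\<^sup>+" for z
    using bspec[OF h, of "(x, y)"] \<open>(x, y) \<in> E\<close> graded_trancl_less[OF h that(1)]
      graded_trancl_less[OF h that(2)] by simp
  ultimately show "covered_by (Id_on A \<union> E\<^sup>+) x y"
    unfolding covered_by_def less_in_graded[OF h] by blast
qed


section \<open>The tree of an increasing parent function\<close>

text \<open>
  The height is prescribed at the root and determined downwards, since \<open>h i\<close> only depends on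
  the height of the larger number \<open>f i\<close>.
\<close>
lemma height_along_parents:
  fixes f :: "nat \<Rightarrow> nat" and d :: "nat \<Rightarrow> int"
  assumes "\<And>i. i \<in> {m..<n} \<Longrightarrow> i < f i"
  obtains h where "\<And>i. i \<in> {m..<n} \<Longrightarrow> h (f i) = h i + d i"
proof -
  have "\<exists>h. \<forall>i \<in> {m..<n}. h (f i) = h i + d i" if "m \<le> n"
    using that assms
  proof (induction rule: inc_induct)
    case base
    then show ?case by simp
  next
    case (step k)
    then obtain h where h: "\<forall>i \<in> {Suc k..<n}. h (f i) = h i + d i"
      by fastforce
    \<comment> \<open>For \<open>i > k\<close> neither \<open>i\<close> nor \<open>f i\<close> equals \<open>k\<close>, so changing \<open>h\<close> at \<open>k\<close> is harmless.\<close>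
    have "(h(k := h (f k) - d k)) (f i) = (h(k := h (f k) - d k)) i + d i"
      if "i \<in> {k..<n}" for i
    proof (cases "i = k")
      case True
      then show ?thesis using step.prems[of k] that by simp
    next
      case False
      then show ?thesis using h step.prems[of i] that by auto
    qed
    then show ?case by blast
  qed
  moreover have "\<exists>h. \<forall>i \<in> {m..<n}. h (f i) = h i + d i" if "\<not> m \<le> n"
    using that by simp
  ultimately show ?thesis using that by blast
qed

definition parent_graph :: "nat \<Rightarrow> (nat \<Rightarrow> nat) \<Rightarrow> nat pair_pre_digraph" where
  "parent_graph n f =
    \<lparr> pverts = {1..n}, parcs = {(x, y). x \<in> {1..<n} \<and> y = f x \<or> y \<in> {1..<n} \<and> x = f y} \<rparr>"

lemma parent_graph_simps [simp]:
  "pverts (parent_graph n f) = {1..n}"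
  "(x, y) \<in> parcs (parent_graph n f) \<longleftrightarrow> x \<in> {1..<n} \<and> y = f x \<or> y \<in> {1..<n} \<and> x = f y"
  by (auto simp: parent_graph_def)

lemma pair_graph_parent_graph:
  assumes f: "\<And>i. i \<in> {1..<n} \<Longrightarrow> i < f i \<and> f i \<le> n"
  shows "pair_graph (parent_graph n f)"
proof -
  have sub: "parcs (parent_graph n f) \<subseteq> {1..n} \<times> {1..n}"
    using f by (fastforce simp: parent_graph_def)
  show ?thesis
  proof
    show "finite (parcs (parent_graph n f))"
      using finite_subset[OF sub] by simp
    show "symmetric (with_proj (parent_graph n f))"
      by (auto simp: symmetric_def intro!: symI)
    show "fst e \<noteq> snd e" if "e \<in> parcs (parent_graph n f)" for e
      using that f by (cases e) fastforce
  qed (use sub in auto)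
qed

lemma connected_parent_graph:
  assumes "n \<ge> 1" and f: "\<And>i. i \<in> {1..<n} \<Longrightarrow> i < f i \<and> f i \<le> n"
  shows "connected (with_proj (parent_graph n f))"
proof -
  let ?G = "parent_graph n f"
  interpret pair_graph ?G
    using f by (rule pair_graph_parent_graph)
  have to_root: "v \<rightarrow>\<^sup>*\<^bsub>with_proj ?G\<^esub> n" if "v \<in> {1..n}" for v
    using that
  proof (induction "n - v" arbitrary: v rule: less_induct)
    case less
    show ?case
    proof (cases "v = n")
      case True
      then show ?thesis using less.prems by simp
    next
      case False
      with less.prems have v: "v \<in> {1..<n}" by simp
      with f[OF v] have "f v \<rightarrow>\<^sup>*\<^bsub>with_proj ?G\<^esub> n"
        by (intro less.hyps) auto
      moreover have "(v, f v) \<in> parcs ?G"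
        using v by simp
      ultimately show ?thesis using adj_reachable_trans[of v "f v" n] by blast
    qed
  qed
  have "u \<rightarrow>\<^sup>*\<^bsub>with_proj ?G\<^esub> v" if "u \<in> {1..n}" "v \<in> {1..n}" for u v
    using to_root[OF that(1)] symmetric_reachable[OF sym_arcs to_root[OF that(2)]]
    by (rule reachable_trans)
  then show ?thesis
    unfolding connected_def using assms(1)
    by (intro strongly_connectedI reachable_mk_symmetricI) auto
qed

text \<open>
  Rotate the cycle so that it starts at its smallest vertex. The vertices after the start and before
  the end are then both larger neighbours of that vertex, so both are its image under \<open>f\<close>;
  but with at least three arcs they are two different vertices of the cycle.
\<close>
lemma no_long_cycle:
  fixes G :: "'a::linorder pair_pre_digraph"
  assumes "pair_graph G"
    and up: "\<And>x y. (x, y) \<in> parcs G \<Longrightarrow> x < y \<Longrightarrow> y = f x"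
    and "pre_digraph.cycle (with_proj G) p"
  shows "length p < 3"
proof (rule ccontr)
  assume "\<not> length p < 3"
  interpret pair_graph G by fact
  obtain u where walk: "awalk u p u" and dist: "distinct (tl (awalk_verts u p))" and "p \<noteq> []"
    using assms(3) unfolding cycle_def by auto
  define m where "m = Min (set (awalk_verts u p))"
  have "m \<in> set (awalk_verts u p)" and m_le: "\<And>v. v \<in> set (awalk_verts u p) \<Longrightarrow> m \<le> v"
    unfolding m_def by (auto intro!: Min_in)
  then obtain q r where "p = q @ r" and walk': "awalk m (r @ q) m"
      and verts': "set (awalk_verts m (r @ q)) = set (awalk_verts u p)"
    using rotate_awalkE[OF walk] by metis
  define c where "c = r @ q"
  have len: "3 \<le> length c"
    using \<open>\<not> length p < 3\<close> \<open>p = q @ r\<close> by (simp add: c_def)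
  then have "c \<noteq> []" by auto
  have cas_c: "cas m c m" and arcs_c: "set c \<subseteq> parcs G"
    using walk' by (auto simp: c_def)
  have heads: "distinct (map snd c)"
  proof -
    have "distinct (map snd p)"
      using dist walk \<open>p \<noteq> []\<close> awalk_verts_conv'[of u p u] by (simp add: awalk_def)
    then show ?thesis
      by (auto simp: \<open>p = q @ r\<close> c_def)
  qed
  have verts_eq: "awalk_verts m c = map fst c @ [snd (last c)]"
      "awalk_verts m c = fst (hd c) # map snd c"
    using \<open>c \<noteq> []\<close> awalk_verts_conv[of m c] awalk_verts_conv'[OF cas_c] by auto
  have step: "fst (c ! Suc i) = snd (c ! i)" if "Suc i < length c" for i
  proof -
    have "(map fst c @ [snd (last c)]) ! Suc i = (fst (hd c) # map snd c) ! Suc i"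
      using verts_eq by simp
    then show ?thesis using that by (simp add: nth_append)
  qed
  have start: "fst (c ! 0) = m" and stop: "snd (c ! (length c - 1)) = m"
    using \<open>c \<noteq> []\<close> verts_eq(1) awlast_if_cas[OF cas_c] verts_eq(2) awhd_if_cas[OF cas_c]
    by (metis hd_conv_nth list.sel(1), metis last_conv_nth last_snoc)
  define x y where "x = fst (c ! (length c - 1))" and "y = snd (c ! 0)"
  have out_arc: "(m, y) \<in> parcs G"
    using arcs_c start \<open>c \<noteq> []\<close> nth_mem[of 0 c] by (force simp: y_def)
  have "c ! (length c - 1) \<in> parcs G"
    using arcs_c \<open>c \<noteq> []\<close> nth_mem[of "length c - 1" c] by force
  then have "(x, m) \<in> parcs G"
    using stop by (metis x_def prod.collapse)
  then have back_arc: "(m, x) \<in> parcs G"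
    by (rule arcs_symmetric)
  have above: "m < v" if "(m, v) \<in> parcs G" "v \<in> set (awalk_verts m c)" for v
    using that m_le[of v] pair_no_loops[OF that(1)] verts' by (auto simp: c_def less_le)
  have "x \<in> set (awalk_verts m c)"
    unfolding verts_eq(1) using \<open>c \<noteq> []\<close> by (simp add: x_def)
  moreover have "y \<in> set (awalk_verts m c)"
    unfolding verts_eq(2) using \<open>c \<noteq> []\<close> by (simp add: y_def)
  ultimately have "x = y"
    using up[OF out_arc] up[OF back_arc] above out_arc back_arc by metis
  moreover have "x = snd (c ! (length c - 2))"
    using step[of "length c - 2"] len by (simp add: x_def numeral_2_eq_2 Suc_diff_Suc)
  ultimately have "map snd c ! 0 = map snd c ! (length c - 2)"
    using len \<open>c \<noteq> []\<close> by (simp add: y_def nth_map)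
  moreover have "0 < length c" "length c - 2 < length c" "0 \<noteq> length c - 2"
    using len by auto
  ultimately show False
    using heads nth_eq_iff_index_eq[of "map snd c" 0 "length c - 2"] by simp
qed

lemma undirected_tree_parent_graph:
  assumes "n \<ge> 1" and f: "\<And>i. i \<in> {1..<n} \<Longrightarrow> i < f i \<and> f i \<le> n"
  shows "undirected_tree (parent_graph n f)"
proof -
  have "y = f x" if "(x, y) \<in> parcs (parent_graph n f)" "x < y" for x y
    using that f[of y] by auto
  then show ?thesis
    unfolding undirected_tree_def
    using pair_graph_parent_graph[OF f] connected_parent_graph[OF assms]
      no_long_cycle[of "parent_graph n f" f] by fastforce
qed

lemma leaf_parent_graph:
  assumes "v \<in> {1..<n}" and "v \<notin> f ` {1..<n}"
  shows "leaf (parent_graph n f) v"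
proof -
  have "out_arcs (with_proj (parent_graph n f)) v = {(v, f v)}"
    using assms by (auto simp: out_arcs_def)
  then show ?thesis
    using assms(1) by (simp add: leaf_def out_degree_def)
qed


section \<open>Covers of the record poset\<close>

lemma next_record:
  assumes "R \<subseteq> {1..n}" "n \<in> R" "i < n"
  shows "next_record R i \<in> R" "i < next_record R i" "next_record R i \<le> n"
proof -
  have "finite {r \<in> R. i < r}"
    using assms(1) by (auto intro: finite_subset)
  then have "next_record R i \<in> {r \<in> R. i < r}"
    unfolding next_record_def by (rule Min_in) (use assms in auto)
  then show "next_record R i \<in> R" "i < next_record R i" "next_record R i \<le> n"
    using assms(1) by auto
qed

lemma record_relations_iff:
  "(x, y) \<in> record_relations n \<epsilon> R \<longleftrightarrow>
    x \<in> {1..<n} \<and> y = next_record R x \<and> (\<epsilon> x = Plus \<and> x \<notin> R \<or> \<epsilon> x = Minus \<and> x \<in> R) \<or>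
    y \<in> {1..<n} \<and> x = next_record R y \<and> \<not> (\<epsilon> y = Plus \<and> y \<notin> R \<or> \<epsilon> y = Minus \<and> y \<in> R)"
proof -
  have "(x, y) \<in> (\<lambda>i. if up i then (i, f i) else (f i, i)) ` A \<longleftrightarrow>
      x \<in> A \<and> y = f x \<and> up x \<or> y \<in> A \<and> x = f y \<and> \<not> up y" for up :: "nat \<Rightarrow> bool" and f A
    by (auto simp: image_iff split: if_splits)
  then show ?thesis unfolding record_relations_def .
qed

lemma record_height:
  assumes "R \<subseteq> {1..n}" "n \<in> R"
  obtains h :: "nat \<Rightarrow> int" where "\<forall>(x, y) \<in> record_relations n \<epsilon> R. h y = h x + 1"
proof -
  define d :: "nat \<Rightarrow> int"
    where "d i = (if \<epsilon> i = Plus \<and> i \<notin> R \<or> \<epsilon> i = Minus \<and> i \<in> R then 1 else -1)" for i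
  obtain h where "\<And>i. i \<in> {1..<n} \<Longrightarrow> h (next_record R i) = h i + d i"
    using height_along_parents[of 1 n "next_record R" d] next_record(2)[OF assms] by auto
  then have "\<forall>(x, y) \<in> record_relations n \<epsilon> R. h y = h x + 1"
    by (fastforce simp: record_relations_iff d_def)
  then show ?thesis by (rule that)
qed

lemma hasse_graph_record_poset:
  assumes "R \<subseteq> {1..n}" "n \<in> R"
  shows "hasse_graph {1..n} (record_poset n \<epsilon> R) = parent_graph n (next_record R)"
proof -
  obtain h :: "nat \<Rightarrow> int" where h: "\<forall>(x, y) \<in> record_relations n \<epsilon> R. h y = h x + 1"
    using record_height[OF assms] by blast
  show ?thesis
    unfolding hasse_graph_def parent_graph_def record_poset_def covered_by_graded[OF h]
    by (auto simp: record_relations_iff)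
qed

lemma partial_order_record_poset:
  assumes "R \<subseteq> {1..n}" "n \<in> R"
  shows "partial_order_on {1..n} (record_poset n \<epsilon> R)"
proof -
  obtain h :: "nat \<Rightarrow> int" where h: "\<forall>(x, y) \<in> record_relations n \<epsilon> R. h y = h x + 1"
    using record_height[OF assms] by blast
  have "record_relations n \<epsilon> R \<subseteq> {1..n} \<times> {1..n}"
    using next_record(2,3)[OF assms] by (fastforce simp: record_relations_iff)
  then show ?thesis
    unfolding record_poset_def using h by (rule partial_order_graded)
qed

text \<open>
  An edge that is oriented downwards cannot be reversed by a longer chain, since every chain
  climbs in height.
\<close>
lemma less_in_record_poset_iff:
  assumes "R \<subseteq> {1..n}" "n \<in> R" "i \<in> {1..<n}"
  shows "less_in (record_poset n \<epsilon> R) i (next_record R i) \<longleftrightarrow>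
    \<epsilon> i = Plus \<and> i \<notin> R \<or> \<epsilon> i = Minus \<and> i \<in> R"
    (is "_ \<longleftrightarrow> ?up")
proof -
  let ?E = "record_relations n \<epsilon> R"
  obtain h :: "nat \<Rightarrow> int" where h: "\<forall>(x, y) \<in> ?E. h y = h x + 1"
    using record_height[OF assms(1,2)] by blast
  have less: "less_in (record_poset n \<epsilon> R) i (next_record R i) \<longleftrightarrow> (i, next_record R i) \<in> ?E\<^sup>+"
    unfolding record_poset_def by (rule less_in_graded[OF h])
  show ?thesis
  proof (cases ?up)
    case True
    then have "(i, next_record R i) \<in> ?E"
      using assms(3) by (simp only: record_relations_iff) blast
    then show ?thesis using True less by blast
  next
    case False
    then have "(next_record R i, i) \<in> ?E"
      using assms(3) by (simp only: record_relations_iff) blast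
    then have "(i, next_record R i) \<notin> ?E\<^sup>+"
      using h graded_trancl_less[OF h] by force
    then show ?thesis using False less by blast
  qed
qed


section \<open>The enumeration of the records\<close>

lemma records_between:
  fixes r :: "nat \<Rightarrow> nat"
  assumes "strict_mono_on {1..s} r" "j \<in> {1..s}" "r (j - 1) \<le> i" "i < r j"
  shows "next_record (r ` {1..s}) i = r j" "r (j - 1) < i \<Longrightarrow> i \<notin> r ` {1..s}"
proof -
  have le: "r a \<le> r b" if "a \<in> {1..s}" "b \<in> {1..s}" "a \<le> b" for a b
    using strict_mono_on_leD[OF assms(1)] that by blast
  \<comment> \<open>For \<open>j = 1\<close> the number \<open>r (j - 1)\<close> need not be a record, but then no index is below \<open>j\<close>.\<close>
  have dich: "r k \<le> r (j - 1) \<or> r j \<le> r k" if "k \<in> {1..s}" for k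
    using le[of k "j - 1"] le[of j k] that assms(2) by (cases "k < j") auto
  show "next_record (r ` {1..s}) i = r j"
    unfolding next_record_def
  proof (rule Min_eqI)
    show "finite {x \<in> r ` {1..s}. i < x}"
      by (rule finite_subset[of _ "r ` {1..s}"]) auto
    show "r j \<le> y" if "y \<in> {x \<in> r ` {1..s}. i < x}" for y
      using that dich assms(3) by fastforce
  qed (use assms in auto)
  show "i \<notin> r ` {1..s}" if "r (j - 1) < i"
    using dich that assms(4) by fastforce
qed

lemma vpath_mapI:
  assumes "a < b" and "inj_on r {a..<b}" and "r ` {a..<b} \<subseteq> pverts G"
    and "\<And>k. a \<le> k \<Longrightarrow> Suc k < b \<Longrightarrow> (r k, r (Suc k)) \<in> parcs G"
  shows "vpath (map r [a..<b]) (with_proj G)"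
proof -
  have arcs: "set (vwalk_arcs xs) \<subseteq> parcs G"
    if "\<And>k. Suc k < length xs \<Longrightarrow> (xs ! k, xs ! Suc k) \<in> parcs G" for xs
    using that
  proof (induction xs rule: vwalk_arcs.induct)
    case (3 x y xs)
    have "(x, y) \<in> parcs G"
      using "3.prems"[of 0] by simp
    moreover have "set (vwalk_arcs (y # xs)) \<subseteq> parcs G"
      by (rule "3.IH") (use "3.prems"[of "Suc _"] in auto)
    ultimately show ?case by simp
  qed auto
  have "set (vwalk_arcs (map r [a..<b])) \<subseteq> parcs G"
    by (rule arcs) (use assms(4) in auto)
  then show ?thesis
    using assms(1-3) by (auto simp: vpath_def vwalk_def distinct_map)
qed

theorem lemma8p1:
  fixes n s :: nat and \<epsilon> :: "nat \<Rightarrow> sign" and R :: "nat set" and r :: "nat \<Rightarrow> nat"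
  assumes "n \<ge> 1"
    and "R \<subseteq> {1..n}"
    and "R = r ` {1..s}" and "strict_mono_on {1..s} r" and "r s = n" and "r 0 = 0"
  defines "Q \<equiv> record_poset n \<epsilon> R"
  defines "H \<equiv> hasse_graph {1..n} Q"
  shows "partial_order_on {1..n} Q
    \<and> caterpillar_with_spine H (map r [1..<s + 1])
    \<and> (\<forall>j \<in> {1..s}. \<forall>i. r (j - 1) < i \<and> i < r j \<longrightarrow>
          leaf H i \<and> (i, r j) \<in> parcs H \<and> (less_in Q i (r j) \<longleftrightarrow> \<epsilon> i = Plus))
    \<and> (\<forall>j \<in> {2..s}. less_in Q (r (j - 1)) (r j) \<longleftrightarrow> \<epsilon> (r (j - 1)) = Minus)"
proof -
  have "s \<ge> 1"
    using assms(1,5,6) by (cases s) auto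
  then have "n \<in> R"
    using assms(3,5) by auto
  note R = \<open>R \<subseteq> {1..n}\<close> \<open>n \<in> R\<close>
  have H: "H = parent_graph n (next_record R)"
    unfolding H_def Q_def using R by (rule hasse_graph_record_poset)
  have parent: "i < next_record R i \<and> next_record R i \<le> n" if "i \<in> {1..<n}" for i
    using that next_record(2,3)[OF R, of i] by simp
  have not_record: "leaf H i" "(i, next_record R i) \<in> parcs H" if "i \<in> {1..n} - R" for i
  proof -
    have i: "i \<in> {1..<n}"
      using that R(2) by (cases "i = n") auto
    moreover have "i \<notin> next_record R ` {1..<n}"
      using that next_record(1)[OF R] by auto
    ultimately show "leaf H i"
      unfolding H by (rule leaf_parent_graph)
    show "(i, next_record R i) \<in> parcs H"
      using i by (simp add: H)
  qed
  have spine: "r (j - 1) \<in> R \<and> r (j - 1) \<in> {1..<n} \<and> next_record R (r (j - 1)) = r j"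
    if "j \<in> {2..s}" for j
  proof -
    have "r (j - 1) < r j"
      using that by (intro strict_mono_onD[OF assms(4)]) auto
    moreover have "j - 1 \<in> {1..s}" "j \<in> {1..s}"
      using that by auto
    then have "r (j - 1) \<in> R" "r j \<in> R"
      unfolding assms(3) by blast+
    moreover from this have "r j \<le> n" "1 \<le> r (j - 1)"
      using R(1) by auto
    ultimately show ?thesis
      using records_between(1)[OF assms(4), of j "r (j - 1)"] that by (auto simp: assms(3))
  qed
  have "vpath (map r [1..<s + 1]) (with_proj H)"
  proof (rule vpath_mapI)
    show "inj_on r {1..<s + 1}"
      using strict_mono_on_imp_inj_on[OF assms(4)] by (simp add: atLeastLessThanSuc_atLeastAtMost)
    show "r ` {1..<s + 1} \<subseteq> pverts H"
      using R(1) by (simp add: H assms(3) atLeastLessThanSuc_atLeastAtMost)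
    show "(r k, r (Suc k)) \<in> parcs H" if "1 \<le> k" "Suc k < s + 1" for k
      using spine[of "Suc k"] that by (simp add: H)
  qed (use \<open>s \<ge> 1\<close> in simp)
  moreover have "set (map r [1..<s + 1]) = R"
    by (auto simp: assms(3))
  moreover have "undirected_tree H"
    unfolding H using assms(1) parent by (rule undirected_tree_parent_graph)
  ultimately have "caterpillar_with_spine H (map r [1..<s + 1])"
    using not_record next_record(1)[OF R] R(2)
    unfolding caterpillar_with_spine_def
    by (metis DiffD1 DiffD2 H atLeastAtMost_iff nat_less_le parent_graph_simps(1))
  moreover have "leaf H i \<and> (i, r j) \<in> parcs H \<and> (less_in Q i (r j) \<longleftrightarrow> \<epsilon> i = Plus)"
    if "j \<in> {1..s}" "r (j - 1) < i" "i < r j" for i j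
  proof -
    have "next_record R i = r j" "i \<notin> R"
      using records_between[OF assms(4), of j i] that by (auto simp: assms(3))
    moreover have "r j \<in> R"
      using that by (simp add: assms(3))
    then have "i \<in> {1..<n}"
      using that R(1) by fastforce
    ultimately show ?thesis
      using not_record[of i] less_in_record_poset_iff[OF R, of i \<epsilon>] by (auto simp: Q_def)
  qed
  moreover have "less_in Q (r (j - 1)) (r j) \<longleftrightarrow> \<epsilon> (r (j - 1)) = Minus" if "j \<in> {2..s}" for j
    using spine[OF that] less_in_record_poset_iff[OF R, of "r (j - 1)" \<epsilon>] by (auto simp: Q_def)
  moreover have "partial_order_on {1..n} Q"
    unfolding Q_def using R by (rule partial_order_record_poset)
  ultimately show ?thesis by blast
qed

end
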